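(* For every isosceles-free metric space $X$ the isometry group $\operatorname{Aut}(X)$ is Boolean.
   Context: $\operatorname{Aut}(X)$ is the group (under composition) of all bijective isometries $X\to X$. A metric space $X$ is isosceles-free if $d(x,y)\neq d(x,z)$ for all pairwise distinct $x,y,z\in X$. A group $G$ is Boolean if $g^2=1$ for every $g\in G$. *)

theory Defs
  imports "HOL-Analysis.Abstract_Metric_Spaces" "HOL-Algebra.Bij"
begin

definition isosceles_free :: "'a set \<Rightarrow> ('a \<Rightarrow> 'a \<Rightarrow> real) \<Rightarrow> bool" where
  "isosceles_free M d \<longleftrightarrow>
     (\<forall>x\<in>M. \<forall>y\<in>M. \<forall>z\<in>M. x \<noteq> y \<and> x \<noteq> z \<and> y \<noteq> z \<longrightarrow> d x y \<noteq> d x z)"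

(* The operations are those of BijGroup: composition and the identity, restricted to M.
   Elements of Bij M are extensional, so each bijection M \<rightarrow> M is represented
   by exactly one HOL function. *)
definition isometry_group :: "'a set \<Rightarrow> ('a \<Rightarrow> 'a \<Rightarrow> real) \<Rightarrow> ('a \<Rightarrow> 'a) monoid" where
  "isometry_group M d =
     (BijGroup M)\<lparr>carrier := {f \<in> Bij M. \<forall>x\<in>M. \<forall>y\<in>M. d (f x) (f y) = d x y}\<rparr>"

definition boolean_group :: "('g, 'b) monoid_scheme \<Rightarrow> bool" where
  "boolean_group G \<longleftrightarrow>
     group G \<and> (\<forall>g\<in>carrier G. g [^]\<^bsub>G\<^esub> (2::nat) = \<one>\<^bsub>G\<^esub>)"

end

theory Submission
  imports Defs
begin

text \<open>
  An isometry \<open>f\<close> carries the pair \<open>x, f x\<close> to the pair \<open>f x, f (f x)\<close>, so \<open>f x\<close> is equidistant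
  from \<open>x\<close> and \<open>f (f x)\<close>. If these three points were distinct they would form an isosceles triangle
  with apex \<open>f x\<close>; hence two of them agree, and injectivity of \<open>f\<close> turns each possible
  coincidence into \<open>f (f x) = x\<close>.
\<close>

lemma subgroup_isometries:
  "subgroup {f \<in> Bij M. \<forall>x\<in>M. \<forall>y\<in>M. d (f x) (f y) = d x y} (BijGroup M)"
  (is "subgroup ?H _")
proof (rule group.subgroupI[OF group_BijGroup])
  show "?H \<subseteq> carrier (BijGroup M)"
    by (auto simp: BijGroup_def)
  have "(\<lambda>x\<in>M. x) \<in> ?H"
    by (simp add: id_Bij)
  then show "?H \<noteq> {}"
    by blast
next
  fix f
  assume f: "f \<in> ?H"
  then have surj: "f ` M = M"
    by (simp add: Bij_def bij_betw_def)
  have "d (inv_into M f x) (inv_into M f y) = d x y" if "x \<in> M" "y \<in> M" for x y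
  proof -
    have "inv_into M f x \<in> M" "inv_into M f y \<in> M"
      using that surj by (metis inv_into_into)+
    then have "d (inv_into M f x) (inv_into M f y)
        = d (f (inv_into M f x)) (f (inv_into M f y))"
      using f by simp
    then show ?thesis
      using that surj by (simp add: f_inv_into_f)
  qed
  then show "inv\<^bsub>BijGroup M\<^esub> f \<in> ?H"
    using f by (simp add: inv_BijGroup restrict_inv_into_Bij)
next
  fix f g
  assume f: "f \<in> ?H" and g: "g \<in> ?H"
  then have "g x \<in> M" if "x \<in> M" for x
    using that by (auto dest: Bij_imp_funcset)
  then show "f \<otimes>\<^bsub>BijGroup M\<^esub> g \<in> ?H"
    using f g by (simp add: BijGroup_def compose_Bij compose_eq)
qed

lemma group_isometry_group: "group (isometry_group M d)"
  unfolding isometry_group_def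
  by (rule subgroup.subgroup_is_group[OF subgroup_isometries group_BijGroup])

lemma isosceles_free_isometry_involutive:
  assumes "Metric_space X d" and iso: "isosceles_free X d"
    and inj: "inj_on f X" and maps: "f \<in> X \<rightarrow> X"
    and pres: "\<forall>x\<in>X. \<forall>y\<in>X. d (f x) (f y) = d x y"
    and x: "x \<in> X"
  shows "f (f x) = x"
proof (rule ccontr)
  assume moved: "f (f x) \<noteq> x"
  have fx: "f x \<in> X" and ffx: "f (f x) \<in> X"
    using maps x by auto
  have "f x \<noteq> x"
    using moved by auto
  then have "f (f x) \<noteq> f x"
    using inj x fx by (auto dest: inj_onD)
  moreover have "d (f x) x = d (f x) (f (f x))"
    using pres x fx Metric_space.commute[OF assms(1)] by metis
  ultimately show False
    using iso moved \<open>f x \<noteq> x\<close> x fx ffx unfolding isosceles_free_def by metis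
qed

theorem proposition3p7:
  fixes X :: "'a set" and d :: "'a \<Rightarrow> 'a \<Rightarrow> real"
  assumes "Metric_space X d"
    and "isosceles_free X d"
  shows "boolean_group (isometry_group X d)"
  unfolding boolean_group_def
proof (intro conjI ballI)
  show group: "group (isometry_group X d)"
    by (rule group_isometry_group)
  fix f
  assume f: "f \<in> carrier (isometry_group X d)"
  then have Bij: "f \<in> Bij X" and pres: "\<forall>x\<in>X. \<forall>y\<in>X. d (f x) (f y) = d x y"
    by (simp_all add: isometry_group_def)
  have "inj_on f X"
    using Bij by (simp add: Bij_def bij_betw_def)
  then have "f (f x) = x" if "x \<in> X" for x
    using isosceles_free_isometry_involutive[OF assms _ Bij_imp_funcset[OF Bij] pres that] by blast
  then have "compose X f f = (\<lambda>x\<in>X. x)"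
    by (auto simp: compose_def)
  then have "f \<otimes>\<^bsub>isometry_group X d\<^esub> f = \<one>\<^bsub>isometry_group X d\<^esub>"
    using Bij by (simp add: isometry_group_def BijGroup_def)
  moreover have "f [^]\<^bsub>isometry_group X d\<^esub> (2::nat) = f \<otimes>\<^bsub>isometry_group X d\<^esub> f"
    using f group by (simp add: numeral_2_eq_2 group.is_monoid monoid.nat_pow_Suc monoid.l_one)
  ultimately show "f [^]\<^bsub>isometry_group X d\<^esub> (2::nat) = \<one>\<^bsub>isometry_group X d\<^esub>"
    by simp
qed

end
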